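(* Let $q=p^m$ with $p$ prime and $m\in\mathbb{N}$, and let $k\in\mathbb{N}$ with $k\mid q-1$. The weak Waring number $w(k,q)$ exists if and only if the Waring number $g(k,q)$ exists, which in turn happens if and only if $\Gamma(k,q)$ is connected. In this case $$w(k,q)=\begin{cases} g(k,q) & \text{if $q$ is even, or $q$ is odd and } v_2(k)<v_2(q-1),\\ g(\tfrac k2,q) & \text{if $q$ is odd and } v_2(k)=v_2(q-1).\end{cases}$$ In other words, $w(k,q)=g(k,q)$ if $\Gamma(k,q)$ is undirected and $w(k,q)=g(\frac k2,q)$ if $\Gamma(k,q)$ is directed.
   Context: $R_k=\{x^k:x\in\mathbb{F}_q^*\}$; the generalized Paley graph $\Gamma(k,q)$ has vertex set $\mathbb{F}_q$ and an arc $x\to y$ iff $y-x\in R_k$; it is undirected if $R_k=-R_k$ and directed otherwise; connectedness means (strong) connectedness. The Waring number $g(k,q)$ is the least $s\in\mathbb{N}$ (if it exists) such that every $a\in\mathbb{F}_q$ can be written as $a=x_1^k+\cdots+x_s^k$ with $x_i\in\mathbb{F}_q$. The weak Waring number $w(k,q)$ is the least $s\in\mathbb{N}$ (if it exists) such that every $a\in\mathbb{F}_q$ can be written as $a=\pm x_1^k\pm\cdots\pm x_s^k$ with $x_i\in\mathbb{F}_q$ and independent choices of signs. $v_2$ is the $2$-adic valuation. *)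

theory Defs
  imports
    "HOL-Library.Cardinality"
    "HOL-Computational_Algebra.Primes"
    "Graph_Theory.Digraph_Component"
begin

definition nonzero_powers :: "nat \<Rightarrow> 'a::field set" where
  "nonzero_powers k = {x ^ k | x. x \<noteq> 0}"

definition gen_paley :: "nat \<Rightarrow> ('a::field, 'a \<times> 'a) pre_digraph" where
  "gen_paley k =
     \<lparr> verts = UNIV, arcs = {(x, y). y - x \<in> nonzero_powers k}, tail = fst, head = snd \<rparr>"

text \<open>The finite field \<open>F\<^sub>q\<close> is a type of class \<open>{field, finite}\<close>; notions whose value does not
  mention field elements take it as an \<open>itself\<close> argument.\<close>

definition gen_paley_undirected :: "'a::field itself \<Rightarrow> nat \<Rightarrow> bool" where
  "gen_paley_undirected _ k \<longleftrightarrow> (nonzero_powers k :: 'a set) = uminus ` nonzero_powers k"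

definition sums_of_powers :: "'a::field itself \<Rightarrow> nat \<Rightarrow> nat \<Rightarrow> bool" where
  "sums_of_powers _ k s \<longleftrightarrow> (\<forall>a::'a. \<exists>x. a = (\<Sum>i<s. x i ^ k))"

definition waring_exists :: "'a::field itself \<Rightarrow> nat \<Rightarrow> bool" where
  "waring_exists F k \<longleftrightarrow> (\<exists>s. sums_of_powers F k s)"

text \<open>The two \<open>LEAST\<close> values are meaningful only under the corresponding existence predicate.
  Admitting \<open>s = 0\<close> is harmless: the empty sum represents only \<open>0\<close>, and a field has
  at least two elements.\<close>

definition waring_number :: "'a::field itself \<Rightarrow> nat \<Rightarrow> nat" where
  "waring_number F k = (LEAST s. sums_of_powers F k s)"

definition signed_sums_of_powers :: "'a::field itself \<Rightarrow> nat \<Rightarrow> nat \<Rightarrow> bool" where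
  "signed_sums_of_powers _ k s \<longleftrightarrow>
     (\<forall>a::'a. \<exists>\<epsilon> x. (\<forall>i<s. \<epsilon> i \<in> {1, - 1}) \<and> a = (\<Sum>i<s. \<epsilon> i * x i ^ k))"

definition weak_waring_exists :: "'a::field itself \<Rightarrow> nat \<Rightarrow> bool" where
  "weak_waring_exists F k \<longleftrightarrow> (\<exists>s. signed_sums_of_powers F k s)"

definition weak_waring_number :: "'a::field itself \<Rightarrow> nat \<Rightarrow> nat" where
  "weak_waring_number F k = (LEAST s. signed_sums_of_powers F k s)"

end

theory Submission
  imports Defs "HOL-Computational_Algebra.Polynomial"
begin

text \<open>Both Waring numbers are the least \<open>s\<close> for which the \<open>s\<close>-fold sumset of a set \<open>A\<close> is the whole
  field: \<open>A\<close> is the set of \<open>k\<close>-th powers in one case and its symmetrisation in the other. If \<open>- 1\<close>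
  is a \<open>k\<close>-th power the two sets agree. Otherwise \<open>(q - 1) / k\<close> is odd, which makes the symmetrised
  set equal to the set of \<open>k / 2\<close>-th powers. Existence and connectedness both say that \<open>A\<close>
  generates the field additively, and signs do not matter for this as \<open>- y\<close> is \<open>q - 1\<close> times \<open>y\<close>.\<close>

section \<open>Iterated sumsets\<close>

text \<open>Exactly \<open>s\<close> summands, repetition allowed; once \<open>0 \<in> A\<close>,
  this amounts to at most \<open>s\<close> summands.\<close>

primrec sumset :: "'a::comm_monoid_add set \<Rightarrow> nat \<Rightarrow> 'a set" where
  "sumset A 0 = {0}"
| "sumset A (Suc s) = {c + b | c b. c \<in> sumset A s \<and> b \<in> A}"

lemma mem_sumset_iff:
  "a \<in> sumset A s \<longleftrightarrow> (\<exists>f. (\<forall>i<s. f i \<in> A) \<and> a = (\<Sum>i<s. f i))"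
proof (induction s arbitrary: a)
  case 0
  show ?case by simp
next
  case (Suc s)
  show ?case
  proof
    assume "a \<in> sumset A (Suc s)"
    then obtain c b where cb: "a = c + b" "c \<in> sumset A s" "b \<in> A" by auto
    then obtain f where f: "\<forall>i<s. f i \<in> A" "c = (\<Sum>i<s. f i)" using Suc.IH by blast
    have "(\<forall>i<Suc s. (f(s := b)) i \<in> A) \<and> a = (\<Sum>i<Suc s. (f(s := b)) i)"
      using cb f by (auto simp: less_Suc_eq intro!: sum.cong)
    then show "\<exists>f. (\<forall>i<Suc s. f i \<in> A) \<and> a = (\<Sum>i<Suc s. f i)" by blast
  next
    assume "\<exists>f. (\<forall>i<Suc s. f i \<in> A) \<and> a = (\<Sum>i<Suc s. f i)"
    then obtain f where f: "\<forall>i<Suc s. f i \<in> A" "a = (\<Sum>i<Suc s. f i)" by blast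
    have "(\<Sum>i<s. f i) \<in> sumset A s"
      unfolding Suc.IH using f(1) by (intro exI[of _ f]) simp
    then show "a \<in> sumset A (Suc s)" using f by auto
  qed
qed

lemma add_mem_sumset:
  assumes "a \<in> sumset A s" "b \<in> sumset A t"
  shows "a + b \<in> sumset A (s + t)"
  using assms(2)
proof (induction t arbitrary: b)
  case 0
  then show ?case using assms(1) by simp
next
  case (Suc t)
  then obtain c d where "b = c + d" "c \<in> sumset A t" "d \<in> A" by auto
  then show ?case using Suc.IH[of c] by (auto simp: add.assoc[symmetric])
qed

lemma sumset_mono_set: "A \<subseteq> B \<Longrightarrow> sumset A s \<subseteq> sumset B s"
  by (induction s) auto

lemma sumset_mono:
  assumes "0 \<in> A" "s \<le> t"
  shows "sumset A s \<subseteq> sumset A t"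
proof (rule lift_Suc_mono_le[OF _ assms(2)])
  show "sumset A n \<subseteq> sumset A (Suc n)" for n using assms(1) by force
qed

lemma of_nat_mult_mem_sumset:
  fixes b :: "'a::semiring_1"
  shows "b \<in> A \<Longrightarrow> of_nat n * b \<in> sumset A n"
  by (induction n) (force simp: algebra_simps)+

text \<open>Each element comes with its own number of summands. By finiteness these numbers have a
  maximum, and padding with zeros makes it work for all elements at once.\<close>

lemma sumset_eq_UNIV_iff_Union:
  fixes A :: "'a::{comm_monoid_add,finite} set"
  assumes "0 \<in> A"
  shows "(\<exists>s. sumset A s = UNIV) \<longleftrightarrow> (\<Union>s. sumset A s) = UNIV"
proof
  assume "(\<Union>s. sumset A s) = UNIV"
  then have "\<forall>a. \<exists>s. a \<in> sumset A s" by blast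
  then obtain t where t: "a \<in> sumset A (t a)" for a by metis
  have "a \<in> sumset A (Max (range t))" for a
    using t[of a] sumset_mono[OF assms, of "t a" "Max (range t)"] by auto
  then show "\<exists>s. sumset A s = UNIV" by blast
qed blast

text \<open>The union over all \<open>s\<close> is the additive monoid generated by the set, so
  adding generators that already lie in it changes nothing.\<close>

lemma Union_sumset_cong:
  fixes A B :: "'a::comm_monoid_add set"
  assumes "A \<subseteq> B" and B: "\<And>b. b \<in> B \<Longrightarrow> b \<in> (\<Union>s. sumset A s)"
  shows "(\<Union>s. sumset B s) = (\<Union>s. sumset A s)"
proof
  have "sumset B s \<subseteq> (\<Union>s. sumset A s)" for s
  proof (induction s)
    case 0
    show ?case by (auto intro: exI[of _ 0])
  next
    case (Suc s)
    show ?case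
    proof
      fix a assume "a \<in> sumset B (Suc s)"
      then obtain c b where "a = c + b" "c \<in> sumset B s" "b \<in> B" by auto
      moreover obtain m where "c \<in> sumset A m" using Suc \<open>c \<in> sumset B s\<close> by blast
      moreover obtain n where "b \<in> sumset A n" using B \<open>b \<in> B\<close> by blast
      ultimately have "a \<in> sumset A (m + n)" using add_mem_sumset by blast
      then show "a \<in> (\<Union>s. sumset A s)" by blast
    qed
  qed
  then show "(\<Union>s. sumset B s) \<subseteq> (\<Union>s. sumset A s)" by blast
  show "(\<Union>s. sumset A s) \<subseteq> (\<Union>s. sumset B s)"
    using sumset_mono_set[OF assms(1)] by blast
qed

section \<open>Finite fields\<close>

text \<open>Multiplication by \<open>x\<close> permutes the nonzero elements. Their product thus
  absorbs one factor \<open>x\<close> per element without changing, and it can be cancelled.\<close>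

lemma finite_field_power_card_minus_one:
  fixes x :: "'a::{field,finite}"
  assumes "x \<noteq> 0"
  shows "x ^ (CARD('a) - 1) = 1"
proof -
  let ?U = "UNIV - {0::'a}"
  have "bij_betw (\<lambda>y. x * y) ?U ?U"
    by (rule bij_betwI[where g = "\<lambda>y. y / x"]) (use assms in auto)
  then have "(\<Prod>y\<in>?U. x * y) = \<Prod>?U"
    by (rule prod.reindex_bij_betw)
  then have "x ^ card ?U * \<Prod>?U = 1 * \<Prod>?U"
    by (simp add: prod.distrib)
  moreover have "\<Prod>?U \<noteq> 0" by simp
  ultimately show ?thesis by (simp add: card_Diff_singleton)
qed

text \<open>The shift by \<open>1\<close> permutes the field, yet adds \<open>1\<close> once per
  element to the sum of all elements.\<close>

lemma of_nat_card_finite_field: "of_nat CARD('a) = (0::'a::{field,finite})"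
proof -
  have "(\<Sum>y\<in>UNIV. y + 1) = (\<Sum>y\<in>UNIV. y::'a)"
    by (rule sum.reindex_bij_betw) (rule bij_betwI[where g = "\<lambda>y. y - 1"], auto)
  then show ?thesis by (simp add: sum.distrib)
qed

lemma card_finite_field_ge_2: "CARD('a::{field,finite}) \<ge> 2"
proof -
  have "card {0, 1::'a} \<le> CARD('a)" by (rule card_mono) auto
  then show ?thesis by simp
qed

lemma of_nat_card_minus_one: "of_nat (CARD('a) - 1) = (- 1 :: 'a::{field,finite})"
  using of_nat_card_finite_field[where 'a = 'a] card_finite_field_ge_2[where 'a = 'a]
  by (simp add: of_nat_diff)

text \<open>For even field size q, the exponent q - 1 is odd and (-1)^(q-1) = 1 reads
  \<open>- 1 = 1\<close>. For odd q, \<open>- 1 = 1\<close> means 2 = 0, so q would be 1 in the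
  field, where it is 0.\<close>

lemma minus_one_eq_one_iff_even_card:
  "(- 1 :: 'a::{field,finite}) = 1 \<longleftrightarrow> even CARD('a)"
proof
  assume "even CARD('a)"
  then have "odd (CARD('a) - 1)" using card_finite_field_ge_2[where 'a = 'a] by simp
  then show "(- 1 :: 'a) = 1"
    using finite_field_power_card_minus_one[of "- 1 :: 'a"] by simp
next
  assume *: "(- 1 :: 'a) = 1"
  show "even CARD('a)"
  proof (rule ccontr)
    assume "odd CARD('a)"
    then obtain n where n: "CARD('a) = 2 * n + 1" by (rule oddE)
    have "(2::'a) = 1 - - 1" by simp
    also have "\<dots> = 0" by (simp only: * diff_self)
    finally have "of_nat (2 * n + 1) = (1::'a)" by simp
    then show False using of_nat_card_finite_field[where 'a = 'a] unfolding n by (metis zero_neq_one)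
  qed
qed

text \<open>A root count replaces a primitive root. With h half of q - 1, each nonzero x^h squares
  to 1; if -1 never occurred, X^h - 1 would have all 2h nonzero elements as roots.\<close>

lemma exists_half_power_eq_minus_one:
  assumes "odd CARD('a::{field,finite})"
  shows "\<exists>x::'a. x ^ ((CARD('a) - 1) div 2) = - 1"
proof (rule ccontr)
  let ?h = "(CARD('a) - 1) div 2"
  assume none: "\<not> ?thesis"
  have h: "2 * ?h = CARD('a) - 1" using assms by simp
  have h0: "?h > 0" using h card_finite_field_ge_2[where 'a = 'a] by linarith
  have "x ^ ?h = 1" if "x \<noteq> 0" for x :: 'a
  proof -
    have "(x ^ ?h)\<^sup>2 = 1"
      using finite_field_power_card_minus_one[OF that] h by (metis mult.commute power_mult)
    then show ?thesis using none by (auto simp: power2_eq_1_iff)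
  qed
  then have sub: "UNIV - {0} \<subseteq> {x::'a. poly (monom 1 ?h - 1) x = 0}"
    by (auto simp: poly_monom)
  have deg: "degree (monom (1::'a) ?h - 1) \<le> ?h"
    by (rule degree_diff_le) (auto simp: degree_monom_le)
  \<comment> \<open>Positivity of \<open>?h\<close> makes the value at \<open>0\<close> equal to
    \<open>- 1\<close>; the polynomial is therefore nonzero and the root bound applies.\<close>
  have "poly (monom (1::'a) ?h - 1) 0 = - 1" using h0 by (simp add: poly_monom)
  then have nz: "monom (1::'a) ?h - 1 \<noteq> 0" by force
  have "CARD('a) - 1 = card (UNIV - {0::'a})" by (simp add: card_Diff_singleton)
  also have "\<dots> \<le> card {x::'a. poly (monom 1 ?h - 1) x = 0}"
    by (rule card_mono[OF _ sub]) simp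
  also have "\<dots> \<le> ?h" using card_poly_roots_bound[OF nz] deg by linarith
  finally show False using h h0 by linarith
qed

text \<open>For odd field size, half of \<open>k * d\<close> is \<open>k * (d div 2)\<close>, so an
  element whose power with this exponent is -1 yields a \<open>k\<close>-th root of -1. For even
  size, -1 = 1 = 1^k.\<close>

lemma minus_one_is_power_if_even_quotient:
  assumes "CARD('a::{field,finite}) - 1 = k * d" and "even d"
  shows "\<exists>x::'a. x ^ k = - 1"
proof (cases "odd CARD('a)")
  case True
  then obtain x :: 'a where "x ^ ((CARD('a) - 1) div 2) = - 1"
    using exists_half_power_eq_minus_one by blast
  then have "(x ^ (d div 2)) ^ k = - 1"
    using assms by (auto simp: power_mult[symmetric] mult.commute)
  then show ?thesis by blast
next
  case False
  then have "(1::'a) ^ k = - 1" using minus_one_eq_one_iff_even_card[where 'a = 'a] by simp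
  then show ?thesis by blast
qed

text \<open>For odd \<open>d\<close>, raising \<open>x ^ k = - 1\<close> to the power
  \<open>d\<close> gives -1, whereas x^(q-1) = 1.\<close>

lemma minus_one_is_power_imp_even_quotient:
  assumes "CARD('a::{field,finite}) - 1 = k * d" and "odd CARD('a)" and "(x::'a) ^ k = - 1" and "k \<ge> 1"
  shows "even d"
proof (rule ccontr)
  assume "odd d"
  have "x \<noteq> 0" using assms by (auto simp: power_0_left)
  then have "1 = (x ^ k) ^ d"
    using finite_field_power_card_minus_one[of x] assms(1) by (simp add: power_mult)
  also have "\<dots> = - 1" using assms(3) \<open>odd d\<close> by simp
  finally show False using minus_one_eq_one_iff_even_card[where 'a = 'a] assms(2) by metis
qed

text \<open>Translates the valuation condition into the parity of the cofactor (q - 1) / k, which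
  decides whether -1 is a \<open>k\<close>-th power for odd q.\<close>

lemma multiplicity_two_less_iff:
  fixes k d :: nat
  assumes "k \<ge> 1" "d \<ge> 1"
  shows "multiplicity 2 k < multiplicity 2 (k * d) \<longleftrightarrow> even d"
proof -
  have "multiplicity 2 (k * d) = multiplicity 2 k + multiplicity 2 d"
    using assms by (intro prime_elem_multiplicity_mult_distrib) auto
  moreover have "multiplicity 2 d > 0 \<longleftrightarrow> even d"
    using assms by (simp add: prime_multiplicity_gt_zero_iff)
  ultimately show ?thesis by simp
qed

section \<open>Powers and signed powers\<close>

definition signed_powers :: "nat \<Rightarrow> 'a::field set" where
  "signed_powers k = range (\<lambda>x. x ^ k) \<union> range (\<lambda>x. - (x ^ k))"

lemma sums_of_powers_iff_sumset:
  "sums_of_powers TYPE('a::field) k s \<longleftrightarrow> sumset (range (\<lambda>x::'a. x ^ k)) s = UNIV"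
proof -
  have "(\<exists>x. a = (\<Sum>i<s. x i ^ k)) \<longleftrightarrow> a \<in> sumset (range (\<lambda>x::'a. x ^ k)) s" for a
  proof
    assume "\<exists>x. a = (\<Sum>i<s. x i ^ k)"
    then obtain x where "a = (\<Sum>i<s. x i ^ k)" by blast
    then show "a \<in> sumset (range (\<lambda>x::'a. x ^ k)) s"
      unfolding mem_sumset_iff by (intro exI[of _ "\<lambda>i. x i ^ k"]) blast
  next
    assume "a \<in> sumset (range (\<lambda>x::'a. x ^ k)) s"
    then obtain f where f: "\<forall>i<s. \<exists>x. f i = x ^ k" "a = (\<Sum>i<s. f i)"
      unfolding mem_sumset_iff by blast
    then obtain x where "\<forall>i<s. f i = x i ^ k" by metis
    then show "\<exists>x. a = (\<Sum>i<s. x i ^ k)" using f(2) by (intro exI[of _ x]) simp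
  qed
  then show ?thesis unfolding sums_of_powers_def by blast
qed

lemma mem_signed_powers_iff:
  "(y::'a::field) \<in> signed_powers k \<longleftrightarrow> (\<exists>\<epsilon> x. \<epsilon> \<in> {1, - 1} \<and> y = \<epsilon> * x ^ k)"
proof -
  have "(\<exists>\<epsilon> x. \<epsilon> \<in> {1, - 1} \<and> y = \<epsilon> * x ^ k) \<longleftrightarrow> (\<exists>x. y = 1 * x ^ k) \<or> (\<exists>x. y = - 1 * x ^ k)"
    by blast
  then show ?thesis unfolding signed_powers_def by auto
qed

lemma signed_sums_of_powers_iff_sumset:
  "signed_sums_of_powers TYPE('a::field) k s \<longleftrightarrow> sumset (signed_powers k :: 'a set) s = UNIV"
proof -
  have "(\<exists>\<epsilon> x. (\<forall>i<s. \<epsilon> i \<in> {1, - 1}) \<and> a = (\<Sum>i<s. \<epsilon> i * x i ^ k)) \<longleftrightarrow>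
      a \<in> sumset (signed_powers k) s" for a :: 'a
  proof
    assume "\<exists>\<epsilon> x. (\<forall>i<s. \<epsilon> i \<in> {1, - 1}) \<and> a = (\<Sum>i<s. \<epsilon> i * x i ^ k)"
    then obtain \<epsilon> x where "\<forall>i<s. \<epsilon> i \<in> {1, - 1}" "a = (\<Sum>i<s. \<epsilon> i * x i ^ k)" by blast
    then show "a \<in> sumset (signed_powers k) s"
      unfolding mem_sumset_iff mem_signed_powers_iff
      by (intro exI[of _ "\<lambda>i. \<epsilon> i * x i ^ k"]) blast
  next
    assume "a \<in> sumset (signed_powers k) s"
    then obtain f where f: "\<forall>i<s. \<exists>\<epsilon> x. \<epsilon> \<in> {1, - 1} \<and> f i = \<epsilon> * x ^ k" "a = (\<Sum>i<s. f i)"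
      unfolding mem_sumset_iff mem_signed_powers_iff by blast
    then obtain \<epsilon> x where "\<forall>i<s. \<epsilon> i \<in> {1, - 1} \<and> f i = \<epsilon> i * x i ^ k" by metis
    then show "\<exists>\<epsilon> x. (\<forall>i<s. \<epsilon> i \<in> {1, - 1}) \<and> a = (\<Sum>i<s. \<epsilon> i * x i ^ k)"
      using f(2) by (intro exI[of _ \<epsilon>] exI[of _ x]) simp
  qed
  then show ?thesis unfolding signed_sums_of_powers_def by blast
qed

lemma zero_mem_range_power: "k \<ge> 1 \<Longrightarrow> 0 \<in> range (\<lambda>x::'a::field. x ^ k)"
  by (intro image_eqI[of _ _ 0]) auto

text \<open>A minus sign is absorbed into the base through the factor \<open>z\<close>.\<close>

lemma signed_powers_eq_powers:
  fixes z :: "'a::field"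
  assumes "z ^ k = - 1"
  shows "signed_powers k = range (\<lambda>x::'a. x ^ k)"
proof -
  have "- (x ^ k) = (z * x) ^ k" for x using assms by (simp add: power_mult_distrib)
  then show ?thesis unfolding signed_powers_def by auto
qed

text \<open>As (q - 1) / j = 2d is even, -1 is a \<open>j\<close>-th power, which gives one
  inclusion. For the other, \<open>x ^ j\<close> becomes a \<open>2 * j\<close>-th power after
  multiplication by a suitable sign.\<close>

lemma signed_powers_double:
  assumes "CARD('a::{field,finite}) - 1 = 2 * j * d" and "odd d" and "j \<ge> 1"
  shows "signed_powers (2 * j) = range (\<lambda>x::'a. x ^ j)"
proof
  obtain z :: 'a where z: "z ^ j = - 1"
    using minus_one_is_power_if_even_quotient[of j "2 * d"] assms(1) by (auto simp: mult_ac)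
  have "x ^ (2 * j) = (x\<^sup>2) ^ j" "- (x ^ (2 * j)) = (z * x\<^sup>2) ^ j" for x
    using z by (simp_all add: power_mult power_mult_distrib)
  then show "signed_powers (2 * j) \<subseteq> range (\<lambda>x::'a. x ^ j)"
    unfolding signed_powers_def by auto
next
  have "x ^ j \<in> signed_powers (2 * j)" for x :: 'a
  proof (cases "x = 0")
    case True
    then have "x ^ j = x ^ (2 * j)" using assms(3) by (simp add: power_0_left)
    then show ?thesis unfolding signed_powers_def by blast
  next
    case False
    \<comment> \<open>This is the required sign: its square is x^(q-1) = 1.\<close>
    define u where "u = x ^ (j * d)"
    have "u\<^sup>2 = 1"
      using finite_field_power_card_minus_one[OF False] assms(1)
      by (simp add: u_def power_mult[symmetric] mult_ac)
    then have u: "u = 1 \<or> u = - 1" by (simp add: power2_eq_1_iff)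
    obtain e where e: "d = 2 * e + 1" using assms(2) by (rule oddE)
    have "x ^ j * u = x ^ (j + j * d)" by (simp add: u_def power_add)
    \<comment> \<open>Oddness of \<open>d\<close> enters here: it makes \<open>1 + d\<close> even,
      hence the exponent a multiple of \<open>2 * j\<close>.\<close>
    also have "j + j * d = (e + 1) * (2 * j)" unfolding e by (simp add: algebra_simps)
    finally have "x ^ j * u = (x ^ (e + 1)) ^ (2 * j)" by (simp only: power_mult)
    then have "x ^ j = (x ^ (e + 1)) ^ (2 * j) \<or> x ^ j = - ((x ^ (e + 1)) ^ (2 * j))"
      using u by (metis minus_minus mult.right_neutral mult_minus_right)
    then show ?thesis unfolding signed_powers_def by blast
  qed
  then show "range (\<lambda>x::'a. x ^ j) \<subseteq> signed_powers (2 * j)" by blast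
qed

text \<open>Symmetry applied to \<open>1 = 1 ^ k\<close> produces -1; conversely, multiplying bases
  by a \<open>k\<close>-th root of -1 negates powers.\<close>

lemma gen_paley_undirected_iff:
  assumes "k \<ge> 1"
  shows "gen_paley_undirected TYPE('a::field) k \<longleftrightarrow> (\<exists>z::'a. z ^ k = - 1)"
proof
  assume "gen_paley_undirected TYPE('a) k"
  then have "(nonzero_powers k :: 'a set) = uminus ` nonzero_powers k"
    by (simp add: gen_paley_undirected_def)
  moreover have "(1::'a) \<in> nonzero_powers k"
    unfolding nonzero_powers_def by (auto intro!: exI[of _ 1])
  ultimately obtain y :: 'a where "y \<in> nonzero_powers k" "1 = - y" by blast
  then have "- 1 \<in> (nonzero_powers k :: 'a set)" by (metis minus_minus)
  then show "\<exists>z::'a. z ^ k = - 1" unfolding nonzero_powers_def by force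
next
  assume "\<exists>z::'a. z ^ k = - 1"
  then obtain z :: 'a where z: "z ^ k = - 1" by blast
  then have z0: "z \<noteq> 0" using assms by (auto simp: power_0_left)
  have neg: "- y \<in> nonzero_powers k" if y: "y \<in> nonzero_powers k" for y :: 'a
  proof -
    obtain x where "y = x ^ k" "x \<noteq> 0" using y unfolding nonzero_powers_def by blast
    then have "- y = (z * x) ^ k" "z * x \<noteq> 0" using z z0 by (auto simp: power_mult_distrib)
    then show ?thesis unfolding nonzero_powers_def by blast
  qed
  have "y \<in> uminus ` nonzero_powers k" if "y \<in> nonzero_powers k" for y :: 'a
    using neg[OF that] by (intro image_eqI[of _ _ "- y"]) auto
  then show "gen_paley_undirected TYPE('a) k"
    unfolding gen_paley_undirected_def using neg by blast
qed

section \<open>Existence of the Waring numbers and connectedness of the graph\<close>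

lemma weak_waring_exists_iff:
  assumes "k \<ge> 1"
  shows "weak_waring_exists TYPE('a::{field,finite}) k \<longleftrightarrow> waring_exists TYPE('a) k"
proof -
  let ?P = "range (\<lambda>x::'a. x ^ k)"
  \<comment> \<open>Removing a sign costs up to q - 1 summands, which is harmless for
    existence.\<close>
  have "b \<in> (\<Union>s. sumset ?P s)" if "b \<in> signed_powers k" for b
  proof -
    have one: "y \<in> sumset ?P 1" if "y \<in> ?P" for y using that by simp
    have "- y \<in> sumset ?P (CARD('a) - 1)" if "y \<in> ?P" for y
      using of_nat_mult_mem_sumset[OF that, of "CARD('a) - 1"]
      by (simp only: of_nat_card_minus_one) simp
    then show ?thesis using that one unfolding signed_powers_def by blast
  qed
  then have "(\<Union>s. sumset (signed_powers k) s) = (\<Union>s. sumset ?P s)"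
    by (intro Union_sumset_cong) (auto simp: signed_powers_def)
  moreover have "0 \<in> ?P" using zero_mem_range_power[OF assms] .
  moreover from this have "(0::'a) \<in> signed_powers k" by (simp add: signed_powers_def)
  ultimately show ?thesis
    unfolding weak_waring_exists_def waring_exists_def
      sums_of_powers_iff_sumset signed_sums_of_powers_iff_sumset
    by (simp add: sumset_eq_UNIV_iff_Union)
qed

text \<open>The steps of a walk are the nonzero summands of \<open>v - u\<close>. Zero summands give
  no arc, so only the union over all \<open>s\<close> corresponds to reachability, not each
  \<open>s\<close> separately.\<close>

lemma gen_paley_reachable_iff:
  fixes u v :: "'a::field"
  assumes "k \<ge> 1"
  shows "u \<rightarrow>\<^sup>*\<^bsub>gen_paley k\<^esub> v \<longleftrightarrow> v - u \<in> (\<Union>s. sumset (range (\<lambda>x. x ^ k)) s)"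
proof
  let ?P = "range (\<lambda>x::'a. x ^ k)"
  have arc: "x \<rightarrow>\<^bsub>gen_paley k\<^esub> y \<longleftrightarrow> y - x \<in> nonzero_powers k" for x y :: 'a
    by (auto simp: gen_paley_def arcs_ends_def arc_to_ends_def image_iff)
  have V: "verts (gen_paley k :: ('a, 'a \<times> 'a) pre_digraph) = UNIV"
    by (simp add: gen_paley_def)
  \<comment> \<open>Reachability confines walks to the vertex set; since that is the whole type, it
    is the ordinary reflexive transitive closure.\<close>
  have reach: "x \<rightarrow>\<^sup>*\<^bsub>gen_paley k\<^esub> y \<longleftrightarrow> (x, y) \<in> (arcs_ends (gen_paley k))\<^sup>*" for x y :: 'a
    unfolding reachable_def V
    by (auto intro: rtrancl_consistent_rtrancl_on rtrancl_on_rtranclI)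
  {
    assume "u \<rightarrow>\<^sup>*\<^bsub>gen_paley k\<^esub> v"
    then have "(u, v) \<in> (arcs_ends (gen_paley k))\<^sup>*" by (simp add: reach)
    then show "v - u \<in> (\<Union>s. sumset ?P s)"
    proof (induction rule: rtrancl_induct)
      case base
      show ?case by (auto intro: exI[of _ 0])
    next
      case (step y z)
      then obtain s where s: "y - u \<in> sumset ?P s" by blast
      have "z - y \<in> ?P" using step(2) arc unfolding nonzero_powers_def by blast
      then have "(y - u) + (z - y) \<in> sumset ?P (Suc s)" using s unfolding sumset.simps by blast
      then show ?case by (auto simp del: sumset.simps)
    qed
  next
    have "(u, u + a) \<in> (arcs_ends (gen_paley k))\<^sup>*" if "a \<in> sumset ?P s" for a s
      using that
    proof (induction s arbitrary: a)
      case 0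
      then show ?case by simp
    next
      case (Suc s)
      then obtain c x where cx: "a = c + x ^ k" "c \<in> sumset ?P s" by auto
      have IH: "(u, u + c) \<in> (arcs_ends (gen_paley k))\<^sup>*" using Suc.IH cx(2) .
      show ?case
      proof (cases "x = 0")
        case True
        then show ?thesis using IH cx(1) assms by (simp add: power_0_left)
      next
        case False
        then have "(u + c) \<rightarrow>\<^bsub>gen_paley k\<^esub> (u + a)"
          unfolding arc cx(1) nonzero_powers_def by auto
        then show ?thesis using IH by (rule rtrancl_into_rtrancl[rotated])
      qed
    qed
    moreover assume "v - u \<in> (\<Union>s. sumset ?P s)"
    ultimately have "(u, u + (v - u)) \<in> (arcs_ends (gen_paley k))\<^sup>*" by blast
    then show "u \<rightarrow>\<^sup>*\<^bsub>gen_paley k\<^esub> v" by (simp add: reach)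
  }
qed

text \<open>Reachability depends only on \<open>v - u\<close>, and with \<open>u = 0\<close> every
  field element is such a difference.\<close>

lemma waring_exists_iff_strongly_connected:
  assumes "k \<ge> 1"
  shows "waring_exists TYPE('a::{field,finite}) k \<longleftrightarrow>
    strongly_connected (gen_paley k :: ('a, 'a \<times> 'a) pre_digraph)"
proof -
  let ?U = "\<Union>s. sumset (range (\<lambda>x::'a. x ^ k)) s"
  have "strongly_connected (gen_paley k :: ('a, 'a \<times> 'a) pre_digraph) \<longleftrightarrow> (\<forall>u v. v - u \<in> ?U)"
    unfolding strongly_connected_def gen_paley_reachable_iff[OF assms]
    by (simp add: gen_paley_def)
  also have "\<dots> \<longleftrightarrow> ?U = UNIV"
    by (metis UNIV_I UNIV_eq_I diff_zero)
  finally show ?thesis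
    unfolding waring_exists_def sums_of_powers_iff_sumset
    by (simp only: sumset_eq_UNIV_iff_Union[OF zero_mem_range_power[OF assms]])
qed

text \<open>The claims \<open>waring_exists TYPE('a) (k div 2)\<close> ensure that the
  \<open>LEAST\<close> value for \<open>k div 2\<close> is a genuine minimum.\<close>

theorem theorem8p3:
  fixes p m q k :: nat
  assumes "prime p" and "m \<ge> 1" and "q = p ^ m"
    and "CARD('a::{field,finite}) = q"
    and "k \<ge> 1" and "k dvd q - 1"
  shows "(weak_waring_exists TYPE('a) k \<longleftrightarrow> waring_exists TYPE('a) k) \<and>
    (waring_exists TYPE('a) k \<longleftrightarrow> strongly_connected (gen_paley k :: ('a, 'a \<times> 'a) pre_digraph)) \<and>
    (weak_waring_exists TYPE('a) k \<longrightarrow>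
      (even q \<or> (odd q \<and> multiplicity 2 k < multiplicity 2 (q - 1)) \<longrightarrow>
        weak_waring_number TYPE('a) k = waring_number TYPE('a) k) \<and>
      (odd q \<and> multiplicity 2 k = multiplicity 2 (q - 1) \<longrightarrow>
        waring_exists TYPE('a) (k div 2) \<and>
        weak_waring_number TYPE('a) k = waring_number TYPE('a) (k div 2)) \<and>
      (gen_paley_undirected TYPE('a) k \<longrightarrow>
        weak_waring_number TYPE('a) k = waring_number TYPE('a) k) \<and>
      (\<not> gen_paley_undirected TYPE('a) k \<longrightarrow>
        waring_exists TYPE('a) (k div 2) \<and>
        weak_waring_number TYPE('a) k = waring_number TYPE('a) (k div 2)))"
proof -
  obtain d where d: "q - 1 = k * d" using assms(6) by (rule dvdE)
  have "q \<ge> 2" using card_finite_field_ge_2[where 'a = 'a] assms(4) by simp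
  then have "d \<ge> 1" using d by (cases d) auto
  \<comment> \<open>Both case distinctions, by valuation and by direction, are reduced to the
    parities of \<open>q\<close> and \<open>d\<close>.\<close>
  have less: "multiplicity 2 k < multiplicity 2 (q - 1) \<longleftrightarrow> even d"
    unfolding d by (rule multiplicity_two_less_iff) fact+
  have undir: "gen_paley_undirected TYPE('a) k \<longleftrightarrow> even q \<or> even d"
  proof -
    have "\<exists>z::'a. z ^ k = - 1" if "even q"
      using that minus_one_eq_one_iff_even_card[where 'a = 'a] assms(4)
      by (intro exI[of _ 1]) simp
    then show ?thesis
      unfolding gen_paley_undirected_iff[OF assms(5)]
      using minus_one_is_power_if_even_quotient[where 'a = 'a, of k d]
        minus_one_is_power_imp_even_quotient[where 'a = 'a, of k d] d assms(4,5) by blast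
  qed
  have A: "weak_waring_number TYPE('a) k = waring_number TYPE('a) k"
    if undirected: "gen_paley_undirected TYPE('a) k"
  proof -
    obtain z :: 'a where "z ^ k = - 1"
      using undirected unfolding gen_paley_undirected_iff[OF assms(5)] by blast
    then show ?thesis
      unfolding weak_waring_number_def waring_number_def
        sums_of_powers_iff_sumset signed_sums_of_powers_iff_sumset
      by (simp add: signed_powers_eq_powers)
  qed
  have B: "waring_exists TYPE('a) (k div 2) \<and>
      weak_waring_number TYPE('a) k = waring_number TYPE('a) (k div 2)"
    if "weak_waring_exists TYPE('a) k" "\<not> gen_paley_undirected TYPE('a) k"
  proof -
    have "odd d" "odd q" using that(2) undir by auto
    \<comment> \<open>Since \<open>q - 1\<close> is even and \<open>d\<close> odd, the factor 2 must
      lie in \<open>k\<close>.\<close>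
    then have "even (k * d)" unfolding d[symmetric] by simp
    then obtain j where j: "k = 2 * j" using \<open>odd d\<close> by auto
    have "signed_powers k = range (\<lambda>x::'a. x ^ j)"
      unfolding j
      using d assms(4,5) \<open>odd d\<close> by (intro signed_powers_double) (auto simp: j)
    \<comment> \<open>The generating sets agree, so the two predicates agree for every
      \<open>s\<close>; existence and least value transfer together.\<close>
    then show ?thesis
      using that(1)
      unfolding weak_waring_number_def waring_number_def weak_waring_exists_def waring_exists_def
        sums_of_powers_iff_sumset signed_sums_of_powers_iff_sumset
      by (simp add: j)
  qed
  \<comment> \<open>Equal valuations rule out the strict inequality, so \<open>d\<close> is odd; for
    odd \<open>q\<close> this is the directed case.\<close>
  show ?thesis
    using A B undir less weak_waring_exists_iff[OF assms(5), where 'a = 'a]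
      waring_exists_iff_strongly_connected[OF assms(5), where 'a = 'a]
    by auto
qed

end
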